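(* Let $((S_1,d_1),\phi_1)$ and $((S_2,d_2),\phi_2)$ be flows of $\mathcal L_{qm}$ and let $\alpha\colon((S_1,d_1),\phi_1)\to((S_2,d_2),\phi_2)$ be an isomorphism in the category of flows of $\mathcal L_{qm}$. Then $\alpha(\mathcal I_{\phi_1}(S_1))=\mathcal I_{\phi_2}(S_2)$ and $\widetilde h(\phi_2)=\widetilde h(\phi_1)$.
   Context: A generalized quasimetric on a non-empty set $S$ is a function $d\colon S\times S\to\mathbb R_{\ge0}\cup\{\infty\}$ with (QM1) $d(x,y)=d(y,x)=0$ if and only if $x=y$, and (QM2) $d(x,z)\le d(x,y)+d(y,z)$ for all $x,y,z$. It induces the partial order $x\le y\iff d(y,x)=0$. The category $\mathcal L_{qm}$ has as objects the pairs $(S,d)$ such that $d$ is a generalized quasimetric, $(S,\le)$ is a join-semilattice (join written $+$) with bottom element $0$, and (QM3) $d(x,y)=d(x,x+y)$ for all $x,y$; its morphisms are the maps $\phi\colon (S,d)\to(S',d')$ with $\phi(x+y)=\phi(x)+\phi(y)$, $\phi(0)=0$ and $d'(\phi(x),\phi(y))\le d(x,y)$ for all $x,y$. A flow of $\mathcal L_{qm}$ is a pair $((S,d),\phi)$ with $(S,d)\in\mathcal L_{qm}$ and $\phi\colon(S,d)\to(S,d)$ an endomorphism in $\mathcal L_{qm}$; a morphism of flows $((S_1,d_1),\phi_1)\to((S_2,d_2),\phi_2)$ is a morphism $\alpha\colon (S_1,d_1)\to (S_2,d_2)$ in $\mathcal L_{qm}$ with $\alpha\circ\phi_1=\phi_2\circ\alpha$.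 For a flow $((S,d),\phi)$ of $\mathcal L_{qm}$, $x\in S$ is $\phi$-inert if $d(x,\phi(x))<\infty$; $\mathcal I_\phi(S)$ is the set of $\phi$-inert elements; $T_n(\phi,x)=x+\phi(x)+\dots+\phi^{n-1}(x)$ for $n\ge1$. For $x\in\mathcal I_\phi(S)$ put $\widetilde h(\phi,x)=\lim_{n\to\infty}\frac{d(x,T_n(\phi,x))}{n}$ (this limit exists), and $\widetilde h(\phi)=\sup\{\widetilde h(\phi,x)\mid x\in\mathcal I_\phi(S)\}\in\mathbb R_{\ge0}\cup\{\infty\}$. *)

theory Defs
  imports "HOL-Algebra.Lattice" "HOL-Library.Extended_Nonnegative_Real"
begin

section \<open>Generalized quasimetric semilattices and their flows\<close>

text \<open>
  A structure \<open>(S, d)\<close> is given by a carrier set and a distance function; only the values of \<open>d\<close>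
  on \<open>S\<close> matter. The codomain of nonnegative reals together with infinity is \<open>ennreal\<close>.
\<close>

definition generalized_quasimetric :: "'a set \<Rightarrow> ('a \<Rightarrow> 'a \<Rightarrow> ennreal) \<Rightarrow> bool" where
  "generalized_quasimetric S d \<longleftrightarrow>
     S \<noteq> {} \<and>
     (\<forall>x\<in>S. \<forall>y\<in>S. (d x y = 0 \<and> d y x = 0) \<longleftrightarrow> x = y) \<and>
     (\<forall>x\<in>S. \<forall>y\<in>S. \<forall>z\<in>S. d x z \<le> d x y + d y z)"

text \<open>
  The order induced by \<open>d\<close>, as an order structure of HOL-Algebra. Note the swapped arguments:
  \<open>x \<le> y\<close> means \<open>d y x = 0\<close>. Joins and the bottom element are not additional data; they are
  those of this order.
\<close>

definition qm_order :: "'a set \<Rightarrow> ('a \<Rightarrow> 'a \<Rightarrow> ennreal) \<Rightarrow> 'a gorder" where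
  "qm_order S d = \<lparr>carrier = S, eq = (=), le = (\<lambda>x y. d y x = 0)\<rparr>"

abbreviation qm_join :: "'a set \<Rightarrow> ('a \<Rightarrow> 'a \<Rightarrow> ennreal) \<Rightarrow> 'a \<Rightarrow> 'a \<Rightarrow> 'a" where
  "qm_join S d x y \<equiv> x \<squnion>\<^bsub>qm_order S d\<^esub> y"

abbreviation qm_zero :: "'a set \<Rightarrow> ('a \<Rightarrow> 'a \<Rightarrow> ennreal) \<Rightarrow> 'a" where
  "qm_zero S d \<equiv> \<bottom>\<^bsub>qm_order S d\<^esub>"

definition Lqm_object :: "'a set \<Rightarrow> ('a \<Rightarrow> 'a \<Rightarrow> ennreal) \<Rightarrow> bool" where
  "Lqm_object S d \<longleftrightarrow>
     generalized_quasimetric S d \<and>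
     upper_semilattice (qm_order S d) \<and>
     weak_partial_order_bottom (qm_order S d) \<and>
     (\<forall>x\<in>S. \<forall>y\<in>S. d x y = d x (qm_join S d x y))"

definition Lqm_morphism ::
  "'a set \<Rightarrow> ('a \<Rightarrow> 'a \<Rightarrow> ennreal) \<Rightarrow> 'b set \<Rightarrow> ('b \<Rightarrow> 'b \<Rightarrow> ennreal) \<Rightarrow> ('a \<Rightarrow> 'b) \<Rightarrow> bool" where
  "Lqm_morphism S d S' d' \<phi> \<longleftrightarrow>
     (\<forall>x\<in>S. \<phi> x \<in> S') \<and>
     (\<forall>x\<in>S. \<forall>y\<in>S. \<phi> (qm_join S d x y) = qm_join S' d' (\<phi> x) (\<phi> y)) \<and>
     \<phi> (qm_zero S d) = qm_zero S' d' \<and>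
     (\<forall>x\<in>S. \<forall>y\<in>S. d' (\<phi> x) (\<phi> y) \<le> d x y)"

definition Lqm_flow :: "'a set \<Rightarrow> ('a \<Rightarrow> 'a \<Rightarrow> ennreal) \<Rightarrow> ('a \<Rightarrow> 'a) \<Rightarrow> bool" where
  "Lqm_flow S d \<phi> \<longleftrightarrow> Lqm_object S d \<and> Lqm_morphism S d S d \<phi>"

definition flow_morphism ::
  "'a set \<Rightarrow> ('a \<Rightarrow> 'a \<Rightarrow> ennreal) \<Rightarrow> ('a \<Rightarrow> 'a) \<Rightarrow>
   'b set \<Rightarrow> ('b \<Rightarrow> 'b \<Rightarrow> ennreal) \<Rightarrow> ('b \<Rightarrow> 'b) \<Rightarrow> ('a \<Rightarrow> 'b) \<Rightarrow> bool" where
  "flow_morphism S\<^sub>1 d\<^sub>1 \<phi>\<^sub>1 S\<^sub>2 d\<^sub>2 \<phi>\<^sub>2 \<alpha> \<longleftrightarrow>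
     Lqm_morphism S\<^sub>1 d\<^sub>1 S\<^sub>2 d\<^sub>2 \<alpha> \<and> (\<forall>x\<in>S\<^sub>1. \<alpha> (\<phi>\<^sub>1 x) = \<phi>\<^sub>2 (\<alpha> x))"

definition flow_isomorphism ::
  "'a set \<Rightarrow> ('a \<Rightarrow> 'a \<Rightarrow> ennreal) \<Rightarrow> ('a \<Rightarrow> 'a) \<Rightarrow>
   'b set \<Rightarrow> ('b \<Rightarrow> 'b \<Rightarrow> ennreal) \<Rightarrow> ('b \<Rightarrow> 'b) \<Rightarrow> ('a \<Rightarrow> 'b) \<Rightarrow> bool" where
  "flow_isomorphism S\<^sub>1 d\<^sub>1 \<phi>\<^sub>1 S\<^sub>2 d\<^sub>2 \<phi>\<^sub>2 \<alpha> \<longleftrightarrow>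
     flow_morphism S\<^sub>1 d\<^sub>1 \<phi>\<^sub>1 S\<^sub>2 d\<^sub>2 \<phi>\<^sub>2 \<alpha> \<and>
     (\<exists>\<beta>. flow_morphism S\<^sub>2 d\<^sub>2 \<phi>\<^sub>2 S\<^sub>1 d\<^sub>1 \<phi>\<^sub>1 \<beta> \<and>
          (\<forall>x\<in>S\<^sub>1. \<beta> (\<alpha> x) = x) \<and> (\<forall>y\<in>S\<^sub>2. \<alpha> (\<beta> y) = y))"

section \<open>Inert elements and the entropy\<close>

definition inert_set :: "'a set \<Rightarrow> ('a \<Rightarrow> 'a \<Rightarrow> ennreal) \<Rightarrow> ('a \<Rightarrow> 'a) \<Rightarrow> 'a set" where
  "inert_set S d \<phi> = {x \<in> S. d x (\<phi> x) < \<infinity>}"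

text \<open>
  \<open>trajectory S d \<phi> x n\<close> is \<open>x + \<phi> x + \<dots> + \<phi>\<^sup>n\<^sup>-\<^sup>1 x\<close>; the value \<open>0\<close> at \<open>n = 0\<close>
  (the empty join) is only a starting point for the recursion.
\<close>

primrec trajectory ::
  "'a set \<Rightarrow> ('a \<Rightarrow> 'a \<Rightarrow> ennreal) \<Rightarrow> ('a \<Rightarrow> 'a) \<Rightarrow> 'a \<Rightarrow> nat \<Rightarrow> 'a" where
  "trajectory S d \<phi> x 0 = qm_zero S d"
| "trajectory S d \<phi> x (Suc n) = qm_join S d (trajectory S d \<phi> x n) ((\<phi> ^^ n) x)"

text \<open>The limit exists, by subadditivity, for all inert \<open>x\<close> of a flow.\<close>

definition local_entropy ::
  "'a set \<Rightarrow> ('a \<Rightarrow> 'a \<Rightarrow> ennreal) \<Rightarrow> ('a \<Rightarrow> 'a) \<Rightarrow> 'a \<Rightarrow> ennreal" where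
  "local_entropy S d \<phi> x = lim (\<lambda>n. d x (trajectory S d \<phi> x n) / of_nat n)"

definition entropy :: "'a set \<Rightarrow> ('a \<Rightarrow> 'a \<Rightarrow> ennreal) \<Rightarrow> ('a \<Rightarrow> 'a) \<Rightarrow> ennreal" where
  "entropy S d \<phi> = (SUP x\<in>inert_set S d \<phi>. local_entropy S d \<phi> x)"

end

theory Submission
  imports Defs
begin

text \<open>
  The entropy is built from the distance, the join, the bottom element and the self-map alone, and
  an isomorphism of flows respects all four. It respects the distance because both it and its
  inverse are contractions, so that distances can neither grow nor shrink
  (\<open>flow_isomorphism_isometry\<close>). It respects the remaining three because a morphism of flows maps
  the trajectory of \<open>x\<close> to the trajectory of \<open>\<alpha> x\<close> (\<open>flow_morphism_trajectory\<close>). The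
  sequences that define the local entropies of \<open>x\<close> and \<open>\<alpha> x\<close> therefore agree term by term, and
  so do their limits. Since \<open>\<alpha>\<close> also maps inert elements
  onto inert elements, the two suprema range over the same values.
\<close>

lemma qm_join_closed:
  assumes "Lqm_object S d" "x \<in> S" "y \<in> S"
  shows "qm_join S d x y \<in> S"
proof -
  interpret upper_semilattice "qm_order S d"
    using assms(1) by (simp add: Lqm_object_def)
  show ?thesis
    using join_closed[of x y] assms(2,3) by (simp add: qm_order_def)
qed

lemma qm_zero_closed:
  assumes "Lqm_object S d"
  shows "qm_zero S d \<in> S"
proof -
  interpret weak_partial_order_bottom "qm_order S d"
    using assms by (simp add: Lqm_object_def)
  show ?thesis
    using bottom_closed by (simp add: qm_order_def)
qed

lemma Lqm_flow_closed:
  assumes "Lqm_flow S d \<phi>" "x \<in> S"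
  shows "\<phi> x \<in> S"
  using assms by (simp add: Lqm_flow_def Lqm_morphism_def)

lemma Lqm_flow_funpow_closed:
  assumes "Lqm_flow S d \<phi>" "x \<in> S"
  shows "(\<phi> ^^ n) x \<in> S"
  using assms by (induction n) (simp_all add: Lqm_flow_closed)

lemma trajectory_closed:
  assumes "Lqm_flow S d \<phi>" "x \<in> S"
  shows "trajectory S d \<phi> x n \<in> S"
proof (induction n)
  case 0
  then show ?case
    using assms(1) by (simp add: Lqm_flow_def qm_zero_closed)
next
  case (Suc n)
  then show ?case
    using assms Lqm_flow_funpow_closed[OF assms]
    by (simp add: Lqm_flow_def qm_join_closed)
qed

lemma flow_morphism_closed:
  assumes "flow_morphism S\<^sub>1 d\<^sub>1 \<phi>\<^sub>1 S\<^sub>2 d\<^sub>2 \<phi>\<^sub>2 \<alpha>" "x \<in> S\<^sub>1"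
  shows "\<alpha> x \<in> S\<^sub>2"
  using assms by (simp add: flow_morphism_def Lqm_morphism_def)

lemma flow_morphism_commute:
  assumes "flow_morphism S\<^sub>1 d\<^sub>1 \<phi>\<^sub>1 S\<^sub>2 d\<^sub>2 \<phi>\<^sub>2 \<alpha>" "x \<in> S\<^sub>1"
  shows "\<alpha> (\<phi>\<^sub>1 x) = \<phi>\<^sub>2 (\<alpha> x)"
  using assms by (simp add: flow_morphism_def)

lemma flow_morphism_contraction:
  assumes "flow_morphism S\<^sub>1 d\<^sub>1 \<phi>\<^sub>1 S\<^sub>2 d\<^sub>2 \<phi>\<^sub>2 \<alpha>" "x \<in> S\<^sub>1" "y \<in> S\<^sub>1"
  shows "d\<^sub>2 (\<alpha> x) (\<alpha> y) \<le> d\<^sub>1 x y"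
  using assms by (simp add: flow_morphism_def Lqm_morphism_def)

lemma flow_morphism_funpow:
  assumes "Lqm_flow S\<^sub>1 d\<^sub>1 \<phi>\<^sub>1" "flow_morphism S\<^sub>1 d\<^sub>1 \<phi>\<^sub>1 S\<^sub>2 d\<^sub>2 \<phi>\<^sub>2 \<alpha>" "x \<in> S\<^sub>1"
  shows "\<alpha> ((\<phi>\<^sub>1 ^^ n) x) = (\<phi>\<^sub>2 ^^ n) (\<alpha> x)"
  by (induction n)
    (simp_all add: flow_morphism_commute[OF assms(2)] Lqm_flow_funpow_closed[OF assms(1,3)])

text \<open>
  Joins are preserved only for elements of the carrier, so the induction uses that a flow keeps
  iterates and trajectories in its carrier.
\<close>

lemma flow_morphism_trajectory:
  assumes "Lqm_flow S\<^sub>1 d\<^sub>1 \<phi>\<^sub>1" "flow_morphism S\<^sub>1 d\<^sub>1 \<phi>\<^sub>1 S\<^sub>2 d\<^sub>2 \<phi>\<^sub>2 \<alpha>" "x \<in> S\<^sub>1"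
  shows "\<alpha> (trajectory S\<^sub>1 d\<^sub>1 \<phi>\<^sub>1 x n) = trajectory S\<^sub>2 d\<^sub>2 \<phi>\<^sub>2 (\<alpha> x) n"
proof (induction n)
  case 0
  then show ?case
    using assms(2) by (simp add: flow_morphism_def Lqm_morphism_def)
next
  case (Suc n)
  have "\<alpha> (qm_join S\<^sub>1 d\<^sub>1 u v) = qm_join S\<^sub>2 d\<^sub>2 (\<alpha> u) (\<alpha> v)" if "u \<in> S\<^sub>1" "v \<in> S\<^sub>1" for u v
    using assms(2) that by (simp add: flow_morphism_def Lqm_morphism_def)
  then show ?case
    using Suc by (simp add: trajectory_closed[OF assms(1,3)] Lqm_flow_funpow_closed[OF assms(1,3)]
        flow_morphism_funpow[OF assms])
qed

text \<open>The inverse is a contraction too, and it returns \<open>\<alpha> x\<close> and \<open>\<alpha> y\<close> to \<open>x\<close> and \<open>y\<close>.\<close>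

lemma flow_isomorphism_isometry:
  assumes "flow_isomorphism S\<^sub>1 d\<^sub>1 \<phi>\<^sub>1 S\<^sub>2 d\<^sub>2 \<phi>\<^sub>2 \<alpha>" "x \<in> S\<^sub>1" "y \<in> S\<^sub>1"
  shows "d\<^sub>2 (\<alpha> x) (\<alpha> y) = d\<^sub>1 x y"
proof (rule antisym)
  from assms(1) obtain \<beta> where \<alpha>: "flow_morphism S\<^sub>1 d\<^sub>1 \<phi>\<^sub>1 S\<^sub>2 d\<^sub>2 \<phi>\<^sub>2 \<alpha>"
    and \<beta>: "flow_morphism S\<^sub>2 d\<^sub>2 \<phi>\<^sub>2 S\<^sub>1 d\<^sub>1 \<phi>\<^sub>1 \<beta>"
    and inv: "\<forall>x\<in>S\<^sub>1. \<beta> (\<alpha> x) = x"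
    by (auto simp: flow_isomorphism_def)
  show "d\<^sub>2 (\<alpha> x) (\<alpha> y) \<le> d\<^sub>1 x y"
    using flow_morphism_contraction[OF \<alpha> assms(2,3)] .
  have "d\<^sub>1 (\<beta> (\<alpha> x)) (\<beta> (\<alpha> y)) \<le> d\<^sub>2 (\<alpha> x) (\<alpha> y)"
    by (intro flow_morphism_contraction[OF \<beta>] flow_morphism_closed[OF \<alpha>] assms(2,3))
  then show "d\<^sub>1 x y \<le> d\<^sub>2 (\<alpha> x) (\<alpha> y)"
    using inv assms(2,3) by simp
qed

lemma flow_isomorphism_image:
  assumes "flow_isomorphism S\<^sub>1 d\<^sub>1 \<phi>\<^sub>1 S\<^sub>2 d\<^sub>2 \<phi>\<^sub>2 \<alpha>"
  shows "\<alpha> ` S\<^sub>1 = S\<^sub>2"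
proof
  from assms obtain \<beta> where \<alpha>: "flow_morphism S\<^sub>1 d\<^sub>1 \<phi>\<^sub>1 S\<^sub>2 d\<^sub>2 \<phi>\<^sub>2 \<alpha>"
    and \<beta>: "flow_morphism S\<^sub>2 d\<^sub>2 \<phi>\<^sub>2 S\<^sub>1 d\<^sub>1 \<phi>\<^sub>1 \<beta>"
    and inv: "\<forall>y\<in>S\<^sub>2. \<alpha> (\<beta> y) = y"
    by (auto simp: flow_isomorphism_def)
  show "\<alpha> ` S\<^sub>1 \<subseteq> S\<^sub>2"
    using flow_morphism_closed[OF \<alpha>] by blast
  show "S\<^sub>2 \<subseteq> \<alpha> ` S\<^sub>1"
    using flow_morphism_closed[OF \<beta>] inv by (metis image_eqI subsetI)
qed

lemma flow_isomorphism_inert_set: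
  assumes "Lqm_flow S\<^sub>1 d\<^sub>1 \<phi>\<^sub>1" "flow_isomorphism S\<^sub>1 d\<^sub>1 \<phi>\<^sub>1 S\<^sub>2 d\<^sub>2 \<phi>\<^sub>2 \<alpha>"
  shows "\<alpha> ` inert_set S\<^sub>1 d\<^sub>1 \<phi>\<^sub>1 = inert_set S\<^sub>2 d\<^sub>2 \<phi>\<^sub>2"
proof -
  have \<alpha>: "flow_morphism S\<^sub>1 d\<^sub>1 \<phi>\<^sub>1 S\<^sub>2 d\<^sub>2 \<phi>\<^sub>2 \<alpha>"
    using assms(2) by (simp add: flow_isomorphism_def)
  have "d\<^sub>2 (\<alpha> x) (\<phi>\<^sub>2 (\<alpha> x)) = d\<^sub>1 x (\<phi>\<^sub>1 x)" if "x \<in> S\<^sub>1" for x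
    using flow_isomorphism_isometry[OF assms(2) that Lqm_flow_closed[OF assms(1) that]]
      flow_morphism_commute[OF \<alpha> that] by simp
  then show ?thesis
    unfolding inert_set_def flow_isomorphism_image[OF assms(2), symmetric] by auto
qed

lemma flow_isomorphism_local_entropy:
  assumes "Lqm_flow S\<^sub>1 d\<^sub>1 \<phi>\<^sub>1" "flow_isomorphism S\<^sub>1 d\<^sub>1 \<phi>\<^sub>1 S\<^sub>2 d\<^sub>2 \<phi>\<^sub>2 \<alpha>" "x \<in> S\<^sub>1"
  shows "local_entropy S\<^sub>2 d\<^sub>2 \<phi>\<^sub>2 (\<alpha> x) = local_entropy S\<^sub>1 d\<^sub>1 \<phi>\<^sub>1 x"
proof -
  have \<alpha>: "flow_morphism S\<^sub>1 d\<^sub>1 \<phi>\<^sub>1 S\<^sub>2 d\<^sub>2 \<phi>\<^sub>2 \<alpha>"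
    using assms(2) by (simp add: flow_isomorphism_def)
  have "d\<^sub>2 (\<alpha> x) (trajectory S\<^sub>2 d\<^sub>2 \<phi>\<^sub>2 (\<alpha> x) n) = d\<^sub>1 x (trajectory S\<^sub>1 d\<^sub>1 \<phi>\<^sub>1 x n)" for n
    using flow_isomorphism_isometry[OF assms(2,3) trajectory_closed[OF assms(1,3)]]
    by (simp add: flow_morphism_trajectory[OF assms(1) \<alpha> assms(3)])
  then show ?thesis
    by (simp add: local_entropy_def)
qed

theorem corollary4p3:
  fixes S\<^sub>1 :: "'a set" and d\<^sub>1 :: "'a \<Rightarrow> 'a \<Rightarrow> ennreal" and \<phi>\<^sub>1 :: "'a \<Rightarrow> 'a"
    and S\<^sub>2 :: "'b set" and d\<^sub>2 :: "'b \<Rightarrow> 'b \<Rightarrow> ennreal" and \<phi>\<^sub>2 :: "'b \<Rightarrow> 'b"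
    and \<alpha> :: "'a \<Rightarrow> 'b"
  assumes "Lqm_flow S\<^sub>1 d\<^sub>1 \<phi>\<^sub>1"
    and "Lqm_flow S\<^sub>2 d\<^sub>2 \<phi>\<^sub>2"
    and "flow_isomorphism S\<^sub>1 d\<^sub>1 \<phi>\<^sub>1 S\<^sub>2 d\<^sub>2 \<phi>\<^sub>2 \<alpha>"
  shows "\<alpha> ` inert_set S\<^sub>1 d\<^sub>1 \<phi>\<^sub>1 = inert_set S\<^sub>2 d\<^sub>2 \<phi>\<^sub>2 \<and>
         entropy S\<^sub>2 d\<^sub>2 \<phi>\<^sub>2 = entropy S\<^sub>1 d\<^sub>1 \<phi>\<^sub>1"
proof
  show inert: "\<alpha> ` inert_set S\<^sub>1 d\<^sub>1 \<phi>\<^sub>1 = inert_set S\<^sub>2 d\<^sub>2 \<phi>\<^sub>2"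
    using flow_isomorphism_inert_set[OF assms(1,3)] .
  have "entropy S\<^sub>2 d\<^sub>2 \<phi>\<^sub>2 = (SUP x\<in>inert_set S\<^sub>1 d\<^sub>1 \<phi>\<^sub>1. local_entropy S\<^sub>2 d\<^sub>2 \<phi>\<^sub>2 (\<alpha> x))"
    unfolding entropy_def inert[symmetric] by (simp add: image_image)
  also have "\<dots> = entropy S\<^sub>1 d\<^sub>1 \<phi>\<^sub>1"
    unfolding entropy_def
    by (intro SUP_cong refl flow_isomorphism_local_entropy[OF assms(1,3)])
      (simp add: inert_set_def)
  finally show "entropy S\<^sub>2 d\<^sub>2 \<phi>\<^sub>2 = entropy S\<^sub>1 d\<^sub>1 \<phi>\<^sub>1" .
qed

end
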